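(* Let $G$ be a simple graph that is $\{-1,0,1\}$-diagonalizable and has $p$ connected components with $v_1, v_2, \ldots, v_p$ vertices, respectively. Then the complement $G^{\textup{c}}$ is $\{-1,0,1\}$-diagonalizable if and only if the vector $(v_1,v_2,\ldots,v_p)$ is balanced. Furthermore, if $G$ has $\{-1,0,1\}$-bandwidth $k$, then $G^{\textup{c}}$ has $\{-1,0,1\}$-bandwidth at most $\max\{p-1,k\}$.
   Context: For a simple graph on $n$ vertices with adjacency matrix $A$ and diagonal degree matrix $D$, the Laplacian is $L=D-A$. For a set $S$, a graph is $S$-diagonalizable if there is an invertible matrix $P$ all of whose entries lie in $S$ such that $P^{-1}LP$ is diagonal (equivalently, a basis of eigenvectors of $L$ with entries in $S$). The bandwidth of a square matrix $M$ is the smallest positive integer $k$ such that $m_{i,j}=0$ whenever $|i-j|\ge k$ (diagonal matrices have bandwidth $1$, tridiagonal bandwidth $2$). The $\{-1,0,1\}$-bandwidth of a graph is $\infty$ if it is not $\{-1,0,1\}$-diagonalizable, and otherwise the smallest positive integer $k$ such that there is a matrix $P$ with entries in $\{-1,0,1\}$, $P^{-1}LP$ diagonal, and $P^TP$ of bandwidth $k$. A vector $\mathbf{v}\in\mathbb{R}^p$ with $p\ge 2$ is balanced if there exists a $(p-1)\times p$ matrix $A$ with all entries in $\{-1,0,1\}$ whose null space equals $\mathrm{span}(\mathbf{v})$; by convention, a vector in $\mathbb{R}^1$ is balanced if and only if it is non-zero.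
   Formalization: The bandwidth bound for the complement is stated only when the vector of component sizes is balanced; otherwise the complement is not {-1,0,1}-diagonalizable and has infinite bandwidth, so the bound fails (e.g. for K_1 ∪ K_2). *)

theory Defs
  imports
    "Graph_Theory.Graph_Theory"
    "Jordan_Normal_Form.Matrix_Kernel"
    "HOL-Library.Extended_Nat"
begin

text \<open>
  A simple graph is a \<^locale>\<open>pair_graph\<close>: a finite, symmetric, loop-free digraph without
  parallel arcs, each edge being a pair of opposite arcs. Its matrices are taken with respect to
  a list \<open>vs\<close> enumerating the vertices without repetition.
\<close>

definition complement :: "'a pair_pre_digraph \<Rightarrow> 'a pair_pre_digraph" where
  "complement G = \<lparr> pverts = pverts G,
     parcs = {(u, v). u \<in> pverts G \<and> v \<in> pverts G \<and> u \<noteq> v \<and> (u, v) \<notin> parcs G} \<rparr>"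

text \<open>As the arcs are symmetric, the strongly connected components are the connected components.\<close>

definition components :: "'a pair_pre_digraph \<Rightarrow> 'a set set" where
  "components G = pre_digraph.sccs_verts (with_proj G)"

definition adjacency_mat :: "'a list \<Rightarrow> 'a pair_pre_digraph \<Rightarrow> real mat" where
  "adjacency_mat vs G =
     mat (length vs) (length vs) (\<lambda>(i, j). if (vs ! i, vs ! j) \<in> parcs G then 1 else 0)"

definition degree_mat :: "'a list \<Rightarrow> 'a pair_pre_digraph \<Rightarrow> real mat" where
  "degree_mat vs G = mat_diag (length vs) (\<lambda>i. real (out_degree (with_proj G) (vs ! i)))"

definition laplacian :: "'a list \<Rightarrow> 'a pair_pre_digraph \<Rightarrow> real mat" where
  "laplacian vs G = degree_mat vs G - adjacency_mat vs G"

text \<open>\<open>P\<close> is invertible with entries in \<open>S\<close>, and \<open>P\<^sup>-\<^sup>1 L P\<close> is diagonal; \<open>Q\<close> is \<open>P\<^sup>-\<^sup>1\<close>.\<close>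

definition diagonalizes :: "real set \<Rightarrow> real mat \<Rightarrow> real mat \<Rightarrow> bool" where
  "diagonalizes S P L \<longleftrightarrow>
     (let n = dim_row L in
      P \<in> carrier_mat n n \<and> elements_mat P \<subseteq> S \<and>
      (\<exists>Q \<in> carrier_mat n n. inverts_mat P Q \<and> inverts_mat Q P \<and> diagonal_mat (Q * L * P)))"

definition diagonalizable :: "real set \<Rightarrow> 'a list \<Rightarrow> 'a pair_pre_digraph \<Rightarrow> bool" where
  "diagonalizable S vs G \<longleftrightarrow> (\<exists>P. diagonalizes S P (laplacian vs G))"

definition mat_bandwidth :: "real mat \<Rightarrow> nat" where
  "mat_bandwidth M = (LEAST k. 0 < k \<and>
     (\<forall>i < dim_row M. \<forall>j < dim_col M. int k \<le> \<bar>int i - int j\<bar> \<longrightarrow> M $$ (i, j) = 0))"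

definition bandwidth :: "real set \<Rightarrow> 'a list \<Rightarrow> 'a pair_pre_digraph \<Rightarrow> enat" where
  "bandwidth S vs G =
     (if diagonalizable S vs G
      then enat (LEAST k. 0 < k \<and>
             (\<exists>P. diagonalizes S P (laplacian vs G) \<and> mat_bandwidth (P\<^sup>T * P) = k))
      else \<infinity>)"

definition balanced :: "real vec \<Rightarrow> bool" where
  "balanced v \<longleftrightarrow>
     (let p = dim_vec v in
      p = 1 \<and> v \<noteq> 0\<^sub>v p \<or>
      p \<ge> 2 \<and> (\<exists>A \<in> carrier_mat (p - 1) p.
                 elements_mat A \<subseteq> {-1, 0, 1} \<and> mat_kernel A = {c \<cdot>\<^sub>v v | c. True}))"

end

theory Submission
  imports Defs "Jordan_Normal_Form.Determinant"
begin

text \<open>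
  With \<open>J\<close> the all-ones matrix, the Laplacian of the complement is \<open>M = n I - J - L\<close>. On vectors of
  sum zero \<open>M\<close> and \<open>L\<close> share their eigenvectors, eigenvalue \<open>d\<close> of \<open>L\<close> turning into \<open>n - d\<close>, and
  the kernel of \<open>L\<close> consists of the vectors \<open>y\<close> that are constant on components. Hence the
  \<open>n\<close>-eigenspace of \<open>M\<close> is \<open>{y. \<Sum> v\<^sub>k y\<^sub>k = 0}\<close>, of dimension \<open>p - 1\<close>, and a basis of it with entries
  in \<open>{-1, 0, 1}\<close> is the same as a matrix witnessing that \<open>v\<close> is balanced. Together with the all-ones
  vector such a basis replaces the kernel columns of a matrix diagonalizing \<open>L\<close>; distinct eigenspaces
  being orthogonal, the Gram matrix gains only one block of size \<open>p - 1\<close> and one of size \<open>1\<close>.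
\<close>

section \<open>Linear algebra with indexed families\<close>

text \<open>Injectivity of a matrix, over arbitrary index sets, so that selected eigenvector columns
  and classes can serve as indices without renumbering.\<close>

definition trivial_kernel :: "'i set \<Rightarrow> 'j set \<Rightarrow> ('i \<Rightarrow> 'j \<Rightarrow> real) \<Rightarrow> bool" where
  "trivial_kernel I J a \<longleftrightarrow>
     (\<forall>f. (\<forall>i\<in>I. (\<Sum>j\<in>J. a i j * f j) = 0) \<longrightarrow> (\<forall>j\<in>J. f j = 0))"

lemma trivial_kernelI:
  assumes "\<And>f j. (\<And>i. i \<in> I \<Longrightarrow> (\<Sum>j\<in>J. a i j * f j) = 0) \<Longrightarrow> j \<in> J \<Longrightarrow> f j = 0"
  shows "trivial_kernel I J a"
  using assms unfolding trivial_kernel_def by blast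

lemma trivial_kernelD:
  assumes "trivial_kernel I J a" "\<And>i. i \<in> I \<Longrightarrow> (\<Sum>j\<in>J. a i j * f j) = 0" "j \<in> J"
  shows "f j = 0"
  using assms unfolding trivial_kernel_def by blast

lemma trivial_kernel_reindex:
  assumes tk: "trivial_kernel I J a" and g: "bij_betw g I' I" and h: "bij_betw h J' J"
  shows "trivial_kernel I' J' (\<lambda>i j. a (g i) (h j))"
proof (rule trivial_kernelI)
  fix f :: "'d \<Rightarrow> real" and j
  assume zero: "\<And>i. i \<in> I' \<Longrightarrow> (\<Sum>j\<in>J'. a (g i) (h j) * f j) = 0" and j: "j \<in> J'"
  let ?f = "\<lambda>j. f (inv_into J' h j)"
  have inv: "inv_into J' h (h j) = j" if "j \<in> J'" for j
    using h that by (simp add: bij_betw_inv_into_left)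
  have "?f (h j) = 0"
  proof (rule trivial_kernelD[OF tk])
    show "h j \<in> J" using h j by (auto simp: bij_betw_def)
    fix i assume "i \<in> I"
    then obtain i' where i': "i' \<in> I'" "i = g i'" using g by (auto simp: bij_betw_def)
    have "(\<Sum>j\<in>J. a i j * ?f j) = (\<Sum>j\<in>J'. a i (h j) * ?f (h j))"
      by (rule sum.reindex_bij_betw[OF h, symmetric])
    also have "\<dots> = (\<Sum>j\<in>J'. a (g i') (h j) * f j)"
      by (rule sum.cong) (simp_all add: inv i'(2))
    finally show "(\<Sum>j\<in>J. a i j * ?f j) = 0" using zero[OF i'(1)] by simp
  qed
  then show "f j = 0" by (simp add: inv j)
qed

lemma mult_mat_vec_eq_sum:
  assumes "A \<in> carrier_mat m n" "x \<in> carrier_vec n" "i < m"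
  shows "(A *\<^sub>v x) $ i = (\<Sum>j<n. A $$ (i, j) * x $ j)"
  using assms by (auto simp: scalar_prod_def atLeast0LessThan intro!: sum.cong)

lemma mult_mat_eq_sum:
  assumes "A \<in> carrier_mat m n" "B \<in> carrier_mat n q" "i < m" "j < q"
  shows "(A * B) $$ (i, j) = (\<Sum>k<n. A $$ (i, k) * B $$ (k, j))"
  using assms by (auto simp: scalar_prod_def atLeast0LessThan intro!: sum.cong)

text \<open>The determinant vanishes exactly when some nonzero vector is annihilated; this carries
  determinant facts over to families.\<close>

lemma det_nonzero_iff_trivial_kernel:
  fixes A :: "real mat"
  assumes A: "A \<in> carrier_mat n n"
  shows "det A \<noteq> 0 \<longleftrightarrow> trivial_kernel {..<n} {..<n} (\<lambda>i j. A $$ (i, j))"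
proof
  assume det: "det A \<noteq> 0"
  show "trivial_kernel {..<n} {..<n} (\<lambda>i j. A $$ (i, j))"
  proof (rule trivial_kernelI)
    fix f j assume zero: "\<And>i. i \<in> {..<n} \<Longrightarrow> (\<Sum>j<n. A $$ (i, j) * f j) = 0" and j: "j \<in> {..<n}"
    have "A *\<^sub>v vec n f = 0\<^sub>v n"
    proof (rule eq_vecI)
      fix i assume "i < dim_vec (0\<^sub>v n :: real vec)"
      then have i: "i < n" by simp
      have "(A *\<^sub>v vec n f) $ i = (\<Sum>j<n. A $$ (i, j) * vec n f $ j)"
        by (rule mult_mat_vec_eq_sum[OF A _ i]) simp
      then show "(A *\<^sub>v vec n f) $ i = 0\<^sub>v n $ i" using zero[of i] i by simp
    qed (use A in auto)
    then have "vec n f = 0\<^sub>v n"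
      using det det_0_iff_vec_prod_zero[OF A] vec_carrier by blast
    then have "vec n f $ j = 0" using j by simp
    then show "f j = 0" using j by simp
  qed
next
  assume tk: "trivial_kernel {..<n} {..<n} (\<lambda>i j. A $$ (i, j))"
  show "det A \<noteq> 0"
  proof
    assume "det A = 0"
    then obtain x where x: "x \<in> carrier_vec n" "x \<noteq> 0\<^sub>v n" "A *\<^sub>v x = 0\<^sub>v n"
      using det_0_iff_vec_prod_zero[OF A] by auto
    have zero: "(\<Sum>j<n. A $$ (i, j) * x $ j) = 0" if "i < n" for i
      using mult_mat_vec_eq_sum[OF A x(1) that] x(3) that by simp
    have "x $ j = 0" if "j < n" for j
      by (rule trivial_kernelD[OF tk, where f = "\<lambda>j. x $ j"]) (use zero that in auto)
    then have "x = 0\<^sub>v n" using x(1) by (intro eq_vecI) auto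
    then show False using x(2) by simp
  qed
qed

text \<open>Transposing preserves the determinant, so for square families independent columns give
  independent rows.\<close>

lemma trivial_kernel_transpose_nat:
  assumes "trivial_kernel {..<n} {..<n::nat} a"
  shows "trivial_kernel {..<n} {..<n} (\<lambda>i j. a j i)"
proof -
  define A where "A = mat n n (\<lambda>(i, j). a i j)"
  have A: "A \<in> carrier_mat n n" by (simp add: A_def)
  have cong: "trivial_kernel {..<n} {..<n} b = trivial_kernel {..<n} {..<n} b'"
    if "\<And>i j. i < n \<Longrightarrow> j < n \<Longrightarrow> b i j = b' i j" for b b' :: "nat \<Rightarrow> nat \<Rightarrow> real"
    unfolding trivial_kernel_def using that by simp
  have "det A \<noteq> 0"
    unfolding det_nonzero_iff_trivial_kernel[OF A]
    by (rule iffD1[OF cong assms]) (simp add: A_def)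
  then have "det A\<^sup>T \<noteq> 0" by (simp add: det_transpose[OF A])
  moreover have AT: "A\<^sup>T \<in> carrier_mat n n" using A by simp
  ultimately have "trivial_kernel {..<n} {..<n} (\<lambda>i j. A\<^sup>T $$ (i, j))"
    using det_nonzero_iff_trivial_kernel by blast
  then show ?thesis
    by (rule iffD1[OF cong, rotated]) (simp add: A_def)
qed

text \<open>Otherwise zero rows pad the family to a square one, whose transpose has a zero column
  although its kernel is trivial. The dimension counts below rest on this bound.\<close>

lemma trivial_kernel_card_le:
  assumes "trivial_kernel I J a" "finite I" "finite J"
  shows "card J \<le> card I"
proof (rule ccontr)
  let ?m = "card J" and ?n = "card I"
  assume "\<not> ?m \<le> ?n"
  then have less: "?n < ?m" by simp
  obtain g h where g: "bij_betw g {..<?n} I" and h: "bij_betw h {..<?m} J"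
    using ex_bij_betw_nat_finite[OF assms(2)] ex_bij_betw_nat_finite[OF assms(3)]
    by (auto simp: atLeast0LessThan)
  let ?b = "\<lambda>i j. if i < ?n then a (g i) (h j) else 0"
  have tk: "trivial_kernel {..<?n} {..<?m} (\<lambda>i j. a (g i) (h j))"
    by (rule trivial_kernel_reindex[OF assms(1) g h])
  have "trivial_kernel {..<?m} {..<?m} ?b"
  proof (rule trivial_kernelI)
    fix f j
    assume zero: "\<And>i. i \<in> {..<?m} \<Longrightarrow> (\<Sum>j<?m. ?b i j * f j) = 0" and j: "j \<in> {..<?m}"
    show "f j = 0"
    proof (rule trivial_kernelD[OF tk])
      show "(\<Sum>j<?m. a (g i) (h j) * f j) = 0" if "i \<in> {..<?n}" for i
        using zero[of i] that less by simp
    qed (use j in auto)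
  qed
  then have tk': "trivial_kernel {..<?m} {..<?m} (\<lambda>i j. ?b j i)"
    by (rule trivial_kernel_transpose_nat)
  \<comment> \<open>The unit vector at \<open>?n\<close> is annihilated, as the padded transpose has
    a zero column there. The goal is its entry at \<open>?n\<close>, left unsimplified so that the
    rule matches.\<close>
  have "(if ?n = ?n then 1 else 0 :: real) = 0"
  proof (rule trivial_kernelD[OF tk', where f = "\<lambda>j. if j = ?n then 1 else 0"])
    show "(\<Sum>j<?m. ?b j i * (if j = ?n then 1 else 0)) = 0" for i
      by (rule sum.neutral) simp
  qed (use less in simp)
  then show False by simp
qed

section \<open>Diagonalization, bandwidth and balance in terms of families\<close>

text \<open>Multiplying \<open>Q * L * P = D\<close> by \<open>P\<close> from the left gives
  \<open>L * P = P * D\<close>, so the inverse disappears and the columns of \<open>P\<close> become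
  eigenvectors.\<close>

lemma diagonalizes_iff:
  assumes L: "L \<in> carrier_mat n n"
  shows "diagonalizes S P L \<longleftrightarrow> P \<in> carrier_mat n n \<and> elements_mat P \<subseteq> S \<and>
    trivial_kernel {..<n} {..<n} (\<lambda>i j. P $$ (i, j)) \<and>
    (\<exists>d. \<forall>i<n. \<forall>j<n. (\<Sum>k<n. L $$ (i, k) * P $$ (k, j)) = d j * P $$ (i, j))" (is "?l \<longleftrightarrow> ?r")
proof
  assume ?l
  then obtain Q where P: "P \<in> carrier_mat n n" and S: "elements_mat P \<subseteq> S"
    and Q: "Q \<in> carrier_mat n n" and PQ: "P * Q = 1\<^sub>m n" and QP: "Q * P = 1\<^sub>m n"
    and diag: "diagonal_mat (Q * L * P)"
    using L unfolding diagonalizes_def Let_def inverts_mat_def by auto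
  define D where "D = Q * L * P"
  have D: "D \<in> carrier_mat n n" using Q L P by (simp add: D_def)
  have "det P * det Q = 1" using det_mult[OF P Q] PQ by simp
  then have "det P \<noteq> 0" by auto
  then have tk: "trivial_kernel {..<n} {..<n} (\<lambda>i j. P $$ (i, j))"
    using det_nonzero_iff_trivial_kernel[OF P] by blast
  have "P * D = (P * Q) * (L * P)"
    unfolding D_def using P Q L by (simp add: assoc_mult_mat[of _ n n _ n _ n])
  then have PD: "P * D = L * P" using PQ L P by simp
  have "(\<Sum>k<n. L $$ (i, k) * P $$ (k, j)) = D $$ (j, j) * P $$ (i, j)" if "i < n" "j < n" for i j
  proof -
    have "(\<Sum>k<n. L $$ (i, k) * P $$ (k, j)) = (P * D) $$ (i, j)"
      using mult_mat_eq_sum[OF L P that] PD by simp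
    also have "\<dots> = (\<Sum>k<n. P $$ (i, k) * D $$ (k, j))"
      by (rule mult_mat_eq_sum[OF P D that])
    also have "\<dots> = (\<Sum>k<n. if k = j then P $$ (i, j) * D $$ (j, j) else 0)"
      using diag D that unfolding diagonal_mat_def D_def[symmetric]
      by (intro sum.cong) auto
    finally show ?thesis using that by simp
  qed
  then have "\<exists>d. \<forall>i<n. \<forall>j<n. (\<Sum>k<n. L $$ (i, k) * P $$ (k, j)) = d j * P $$ (i, j)"
    by (intro exI[of _ "\<lambda>j. D $$ (j, j)"]) simp
  then show ?r using P S tk by simp
next
  assume ?r
  then obtain d where P: "P \<in> carrier_mat n n" and S: "elements_mat P \<subseteq> S"
    and tk: "trivial_kernel {..<n} {..<n} (\<lambda>i j. P $$ (i, j))"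
    and d: "\<And>i j. i < n \<Longrightarrow> j < n \<Longrightarrow> (\<Sum>k<n. L $$ (i, k) * P $$ (k, j)) = d j * P $$ (i, j)"
    by blast
  have "det P \<noteq> 0" using tk det_nonzero_iff_trivial_kernel[OF P] by blast
  from det_non_zero_imp_unit[OF P this, of "()"]
  obtain Q where Q: "Q \<in> carrier_mat n n" and QP: "Q * P = 1\<^sub>m n" and PQ: "P * Q = 1\<^sub>m n"
    unfolding Units_def ring_mat_def by auto
  have LP: "L * P = P * mat_diag n d"
  proof (rule eq_matI)
    fix i j assume "i < dim_row (P * mat_diag n d)" "j < dim_col (P * mat_diag n d)"
    then have ij: "i < n" "j < n" using P by (auto simp: mat_diag_def)
    then show "(L * P) $$ (i, j) = (P * mat_diag n d) $$ (i, j)"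
      using mult_mat_eq_sum[OF L P ij] d[OF ij] P by (simp add: mat_diag_mult_right)
  qed (use L P in \<open>auto simp: mat_diag_def\<close>)
  have "Q * L * P = (Q * P) * mat_diag n d"
    using P Q L LP mat_diag_dim[of n d] by (simp add: assoc_mult_mat[of _ n n _ n _ n])
  then have "Q * L * P = mat_diag n d" using QP mat_diag_dim[of n d] by simp
  then have "diagonal_mat (Q * L * P)" by (auto simp: diagonal_mat_def mat_diag_def)
  then show ?l using P S Q QP PQ L unfolding diagonalizes_def Let_def inverts_mat_def by auto
qed

lemma mat_bandwidth_banded:
  shows "0 < mat_bandwidth M"
    and "\<And>i j. i < dim_row M \<Longrightarrow> j < dim_col M \<Longrightarrow> int (mat_bandwidth M) \<le> \<bar>int i - int j\<bar>
           \<Longrightarrow> M $$ (i, j) = 0"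
proof -
  let ?B = "\<lambda>k. 0 < k \<and> (\<forall>i < dim_row M. \<forall>j < dim_col M. int k \<le> \<bar>int i - int j\<bar> \<longrightarrow> M $$ (i, j) = 0)"
  \<comment> \<open>No two indices differ by this much, so the \<open>LEAST\<close> is attained; the
    summand 1 keeps the bound positive for an empty matrix.\<close>
  have "?B (dim_row M + dim_col M + 1)" by auto
  from LeastI[of ?B, OF this] have *: "?B (mat_bandwidth M)" unfolding mat_bandwidth_def .
  then show "0 < mat_bandwidth M" by blast
  show "\<And>i j. i < dim_row M \<Longrightarrow> j < dim_col M \<Longrightarrow> int (mat_bandwidth M) \<le> \<bar>int i - int j\<bar>
           \<Longrightarrow> M $$ (i, j) = 0" using * by blast
qed

lemma mat_bandwidth_le:
  assumes "0 < k"
    and "\<And>i j. i < dim_row M \<Longrightarrow> j < dim_col M \<Longrightarrow> int k \<le> \<bar>int i - int j\<bar> \<Longrightarrow> M $$ (i, j) = 0"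
  shows "mat_bandwidth M \<le> k"
  unfolding mat_bandwidth_def by (rule Least_le) (use assms in blast)

text \<open>Trades vectors and matrices for functions and absorbs the convention for
  \<open>p = 1\<close>: there are no rows then, and every \<open>w\<close> is a multiple of the
  nonzero \<open>v 0\<close>.\<close>

lemma balanced_iff:
  assumes p: "p \<ge> 1" and v: "\<And>k. k < p \<Longrightarrow> v k \<noteq> 0"
  shows "balanced (vec p v) \<longleftrightarrow> (\<exists>A::nat \<Rightarrow> nat \<Rightarrow> real. (\<forall>r<p-1. \<forall>k<p. A r k \<in> {-1, 0, 1}) \<and>
    (\<forall>w. (\<forall>r<p-1. (\<Sum>k<p. A r k * w k) = 0) \<longleftrightarrow> (\<exists>\<beta>. \<forall>k<p. w k = \<beta> * v k)))" (is "_ \<longleftrightarrow> ?r")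
proof (cases "p = 1")
  case True
  have "(vec p v) \<noteq> 0\<^sub>v p"
  proof
    assume "vec p v = 0\<^sub>v p"
    then have "vec p v $ 0 = 0" using True by simp
    then show False using v True by simp
  qed
  then have "balanced (vec p v)" using True unfolding balanced_def by simp
  moreover have "?r"
    using True v[of 0] by (intro exI[of _ "\<lambda>_ _. 0"]) (auto intro: exI[of _ "w 0 / v 0" for w])
  ultimately show ?thesis by simp
next
  case False
  with p have p2: "p \<ge> 2" by simp
  have ker: "mat_kernel A = {c \<cdot>\<^sub>v vec p v | c. True} \<longleftrightarrow>
     (\<forall>w. (\<forall>r<p-1. (\<Sum>k<p. A $$ (r, k) * w k) = 0) \<longleftrightarrow> (\<exists>\<beta>. \<forall>k<p. w k = \<beta> * v k))"
    if A: "A \<in> carrier_mat (p - 1) p" for A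
  proof -
    have in_ker: "x \<in> mat_kernel A \<longleftrightarrow> (\<forall>r<p-1. (\<Sum>k<p. A $$ (r, k) * x $ k) = 0)"
      if x: "x \<in> carrier_vec p" for x
    proof -
      have "A *\<^sub>v x = 0\<^sub>v (p - 1) \<longleftrightarrow> (\<forall>r<p-1. (A *\<^sub>v x) $ r = 0)"
      proof
        assume "A *\<^sub>v x = 0\<^sub>v (p - 1)"
        then show "\<forall>r<p-1. (A *\<^sub>v x) $ r = 0" by simp
      next
        assume "\<forall>r<p-1. (A *\<^sub>v x) $ r = 0"
        then show "A *\<^sub>v x = 0\<^sub>v (p - 1)" using A by (intro eq_vecI) auto
      qed
      also have "\<dots> \<longleftrightarrow> (\<forall>r<p-1. (\<Sum>k<p. A $$ (r, k) * x $ k) = 0)"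
        using mult_mat_vec_eq_sum[OF A x] by simp
      finally show ?thesis using A x unfolding mat_kernel_def by auto
    qed
    have in_span: "x \<in> {c \<cdot>\<^sub>v vec p v | c. True} \<longleftrightarrow> (\<exists>\<beta>. \<forall>k<p. x $ k = \<beta> * v k)"
      if "x \<in> carrier_vec p" for x
    proof -
      have "x = \<beta> \<cdot>\<^sub>v vec p v \<longleftrightarrow> (\<forall>k<p. x $ k = \<beta> * v k)" for \<beta>
        using that by (auto simp: vec_eq_iff)
      then show ?thesis by simp
    qed
    have "mat_kernel A = {c \<cdot>\<^sub>v vec p v | c. True} \<longleftrightarrow>
       (\<forall>x\<in>carrier_vec p. x \<in> mat_kernel A \<longleftrightarrow> x \<in> {c \<cdot>\<^sub>v vec p v | c. True})"
      using A by (auto simp: mat_kernel_def)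
    also have "\<dots> \<longleftrightarrow> (\<forall>x\<in>carrier_vec p. (\<forall>r<p-1. (\<Sum>k<p. A $$ (r, k) * x $ k) = 0)
        \<longleftrightarrow> (\<exists>\<beta>. \<forall>k<p. x $ k = \<beta> * v k))"
      using in_ker in_span by blast
    also have "\<dots> \<longleftrightarrow> (\<forall>w. (\<forall>r<p-1. (\<Sum>k<p. A $$ (r, k) * w k) = 0)
        \<longleftrightarrow> (\<exists>\<beta>. \<forall>k<p. w k = \<beta> * v k))" (is "?a \<longleftrightarrow> ?b")
    proof
      \<comment> \<open>Both conditions see \<open>w\<close> only below \<open>p\<close>, so
        \<open>vec p w\<close> can stand in for it.\<close>
      assume a: ?a
      show ?b
      proof
        fix w
        show "(\<forall>r<p-1. (\<Sum>k<p. A $$ (r, k) * w k) = 0) \<longleftrightarrow> (\<exists>\<beta>. \<forall>k<p. w k = \<beta> * v k)"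
          using bspec[OF a, of "vec p w"] by simp
      qed
    qed blast
    finally show ?thesis .
  qed
  show ?thesis
  proof
    assume "balanced (vec p v)"
    then obtain A where A: "A \<in> carrier_mat (p - 1) p" "elements_mat A \<subseteq> {-1, 0, 1}"
      "mat_kernel A = {c \<cdot>\<^sub>v vec p v | c. True}"
      using False unfolding balanced_def by auto
    have "A $$ (r, k) \<in> {-1, 0, 1}" if "r < p - 1" "k < p" for r k
      using A(1,2) that by (meson elements_matI subsetD)
    then show ?r using ker[OF A(1)] A(3) by (intro exI[of _ "\<lambda>r k. A $$ (r, k)"]) blast
  next
    assume ?r
    then obtain A :: "nat \<Rightarrow> nat \<Rightarrow> real" where A: "\<forall>r<p-1. \<forall>k<p. A r k \<in> {-1, 0, 1}"
      "\<forall>w. (\<forall>r<p-1. (\<Sum>k<p. A r k * w k) = 0) \<longleftrightarrow> (\<exists>\<beta>. \<forall>k<p. w k = \<beta> * v k)" by blast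
    let ?A = "mat (p - 1) p (\<lambda>(r, k). A r k)"
    have "mat_kernel ?A = {c \<cdot>\<^sub>v vec p v | c. True}"
      unfolding ker[OF mat_carrier] using A(2) by simp
    moreover have "elements_mat ?A \<subseteq> {-1, 0, 1}"
      using A(1) by (fastforce dest!: elements_matD)
    ultimately show "balanced (vec p v)"
      using p2 mat_carrier unfolding balanced_def Let_def by auto
  qed
qed

section \<open>Symmetric matrices whose kernel consists of the class functions\<close>

text \<open>Isolates what the argument needs of a Laplacian: symmetry and the shape of the kernel.
  The map \<open>c\<close> sends a vertex position to its component.\<close>

locale class_matrix =
  fixes n p :: nat and l :: "nat \<Rightarrow> nat \<Rightarrow> real" and c :: "nat \<Rightarrow> nat"
  assumes l_sym: "\<And>i j. i < n \<Longrightarrow> j < n \<Longrightarrow> l i j = l j i"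
    and kernel_iff: "\<And>x. (\<forall>i<n. (\<Sum>j<n. l i j * x j) = 0) \<longleftrightarrow> (\<exists>y. \<forall>i<n. x i = y (c i))"
    and c_less: "\<And>i. i < n \<Longrightarrow> c i < p"
    and c_surj: "\<And>k. k < p \<Longrightarrow> \<exists>i<n. c i = k"
    and n_pos: "0 < n"
begin

definition v :: "nat \<Rightarrow> real" where
  "v k = real (card {i. i < n \<and> c i = k})"

text \<open>The matrix \<open>n I - J - l\<close>, with \<open>J\<close> all ones;
  \<open>laplacian_complement_index\<close> matches it with the Laplacian of the complement.\<close>

definition m :: "nat \<Rightarrow> nat \<Rightarrow> real" where
  "m i j = (if i = j then real n else 0) - 1 - l i j"

lemma p_pos: "1 \<le> p"
  using c_less[OF n_pos] by simp

lemma v_pos: "k < p \<Longrightarrow> 0 < v k"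
  unfolding v_def using c_surj[of k] by (auto simp: card_gt_0_iff)

text \<open>Grouping positions by class turns inner products of class functions into inner products
  on \<open>{..<p}\<close> weighted by the class sizes.\<close>

lemma sum_class: "(\<Sum>i<n. y (c i)) = (\<Sum>k<p. v k * y k)"
proof -
  have "(\<Sum>i<n. y (c i)) = (\<Sum>k<p. \<Sum>i\<in>{i \<in> {..<n}. c i = k}. y (c i))"
    by (rule sum.group[symmetric]) (use c_less in auto)
  also have "\<dots> = (\<Sum>k<p. v k * y k)"
    by (rule sum.cong) (auto simp: v_def)
  finally show ?thesis .
qed

lemma l_class: "i < n \<Longrightarrow> (\<Sum>j<n. l i j * y (c j)) = 0"
  using kernel_iff[of "\<lambda>i. y (c i)"] by blast

lemma l_row_sum: "i < n \<Longrightarrow> (\<Sum>j<n. l i j) = 0"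
  using l_class[of i "\<lambda>_. 1"] by simp

text \<open>Self-adjointness of \<open>l\<close>, the source of all orthogonality between its
  eigenvectors and class functions.\<close>

lemma l_swap: "(\<Sum>i<n. x i * (\<Sum>j<n. l i j * y j)) = (\<Sum>i<n. (\<Sum>j<n. l i j * x j) * y i)"
proof -
  have "(\<Sum>i<n. x i * (\<Sum>j<n. l i j * y j)) = (\<Sum>i<n. \<Sum>j<n. l i j * x i * y j)"
    by (simp add: sum_distrib_left algebra_simps)
  also have "\<dots> = (\<Sum>j<n. \<Sum>i<n. l i j * x i * y j)" by (rule sum.swap)
  also have "\<dots> = (\<Sum>j<n. \<Sum>i<n. l j i * x i * y j)"
    by (intro sum.cong refl) (simp add: l_sym)
  also have "\<dots> = (\<Sum>i<n. (\<Sum>j<n. l i j * x j) * y i)" by (simp add: sum_distrib_right)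
  finally show ?thesis .
qed

lemma m_apply: "i < n \<Longrightarrow> (\<Sum>j<n. m i j * x j) = real n * x i - (\<Sum>j<n. x j) - (\<Sum>j<n. l i j * x j)"
  unfolding m_def by (simp add: left_diff_distrib sum_subtractf if_distrib[of "\<lambda>z. z * _"] cong: if_cong)

text \<open>Self-adjointness holds for each of the three summands of \<open>m\<close>.\<close>

lemma m_swap: "(\<Sum>i<n. x i * (\<Sum>j<n. m i j * y j)) = (\<Sum>i<n. (\<Sum>j<n. m i j * x j) * y i)"
proof -
  have "(\<Sum>i<n. x i * (\<Sum>j<n. m i j * y j)) =
      (\<Sum>i<n. x i * (real n * y i)) - (\<Sum>i<n. x i) * (\<Sum>j<n. y j) - (\<Sum>i<n. x i * (\<Sum>j<n. l i j * y j))"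
    by (simp add: m_apply right_diff_distrib sum_subtractf flip: sum_distrib_right)
  also have "\<dots> = (\<Sum>i<n. (\<Sum>j<n. m i j * x j) * y i)"
    unfolding l_swap
    by (simp add: m_apply left_diff_distrib sum_subtractf mult.left_commute mult.assoc flip: sum_distrib_left)
  finally show ?thesis .
qed

text \<open>Both \<open>l\<close> and the all-ones matrix annihilate such a class function, leaving
  \<open>n\<close> times the identity.\<close>

lemma m_class:
  assumes "i < n" "(\<Sum>k<p. v k * y k) = 0"
  shows "(\<Sum>j<n. m i j * y (c j)) = real n * y (c i)"
  using assms by (simp add: m_apply l_class sum_class)

text \<open>Converse of \<open>m_class\<close>. The eigenvalue equation makes \<open>l x\<close>
  constant, equal to minus the sum of \<open>x\<close>. The entries of \<open>l x\<close> add up to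
  0, so this constant is 0 and \<open>x\<close> lies in the kernel of \<open>l\<close>.\<close>

lemma eigenvector_m_n:
  assumes "\<And>i. i < n \<Longrightarrow> (\<Sum>j<n. m i j * x j) = real n * x i"
  obtains y where "\<And>i. i < n \<Longrightarrow> x i = y (c i)" "(\<Sum>k<p. v k * y k) = 0"
proof -
  have eq: "(\<Sum>j<n. l i j * x j) = - (\<Sum>j<n. x j)" if "i < n" for i
    using assms[OF that] m_apply[OF that, of x] by simp
  \<comment> \<open>Pairing with the all-ones vector; the factor 1 lets \<open>l_swap\<close>
    apply.\<close>
  have "(\<Sum>i<n. 1 * (\<Sum>j<n. l i j * x j)) = 0"
    unfolding l_swap by (simp add: l_row_sum)
  then have "real n * (\<Sum>j<n. x j) = 0" using eq by (simp add: sum_negf)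
  then have sum: "(\<Sum>j<n. x j) = 0" using n_pos by simp
  then obtain y where y: "\<And>i. i < n \<Longrightarrow> x i = y (c i)" using eq kernel_iff[of x] by auto
  have "(\<Sum>k<p. v k * y k) = 0" using sum y by (simp flip: sum_class)
  with y that show ?thesis by blast
qed

lemma orthogonal_class:
  assumes "d \<noteq> 0" "\<And>i. i < n \<Longrightarrow> (\<Sum>j<n. l i j * x j) = d * x i"
  shows "(\<Sum>i<n. x i * y (c i)) = 0"
proof -
  have "d * (\<Sum>i<n. x i * y (c i)) = (\<Sum>i<n. (\<Sum>j<n. l i j * x j) * y (c i))"
    using assms(2) by (simp add: sum_distrib_left mult.assoc)
  also have "\<dots> = (\<Sum>i<n. x i * (\<Sum>j<n. l i j * y (c j)))" by (rule l_swap[symmetric])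
  also have "\<dots> = 0" by (simp add: l_class)
  finally show ?thesis using assms(1) by simp
qed

text \<open>Orthogonality to the constant function 1 gives \<open>x\<close> sum zero, which removes
  the all-ones term.\<close>

lemma m_eigenvector:
  assumes "d \<noteq> 0" "\<And>i. i < n \<Longrightarrow> (\<Sum>j<n. l i j * x j) = d * x i" "i < n"
  shows "(\<Sum>j<n. m i j * x j) = (real n - d) * x i"
  using orthogonal_class[OF assms(1,2), of "\<lambda>_. 1"] assms(2,3)
  by (simp add: m_apply left_diff_distrib)

text \<open>By \<open>m_class\<close> the class function is an eigenvector of \<open>m\<close> for
  \<open>n\<close>, and eigenvectors of a self-adjoint map for different eigenvalues are
  orthogonal.\<close>

lemma m_orthogonal:
  assumes "\<mu> \<noteq> real n" "\<And>i. i < n \<Longrightarrow> (\<Sum>j<n. m i j * x j) = \<mu> * x i"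
    and "(\<Sum>k<p. v k * y k) = 0"
  shows "(\<Sum>i<n. x i * y (c i)) = 0"
proof -
  have "\<mu> * (\<Sum>i<n. x i * y (c i)) = (\<Sum>i<n. (\<Sum>j<n. m i j * x j) * y (c i))"
    using assms(2) by (simp add: sum_distrib_left mult.assoc)
  also have "\<dots> = (\<Sum>i<n. x i * (\<Sum>j<n. m i j * y (c j)))" by (rule m_swap[symmetric])
  also have "\<dots> = real n * (\<Sum>i<n. x i * y (c i))"
    using assms(3) by (simp add: m_class mult.left_commute flip: sum_distrib_left)
  finally show ?thesis using assms(1) by simp
qed

section \<open>From an eigenbasis of \<open>m\<close> to a balanced vector\<close>

text \<open>Columns of \<open>P\<close> with eigenvalue \<open>n\<close> are class functions. Read
  off at one representative per class, they form the rows of \<open>A\<close>, whose entries are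
  therefore entries of \<open>P\<close>.\<close>

lemma balanced_of_eigenbasis:
  fixes P :: "nat \<Rightarrow> nat \<Rightarrow> real"
  assumes tk: "trivial_kernel {..<n} {..<n} P"
    and ev: "\<And>i j. i < n \<Longrightarrow> j < n \<Longrightarrow> (\<Sum>k<n. m i k * P k j) = \<mu> j * P i j"
    and S: "\<And>i j. i < n \<Longrightarrow> j < n \<Longrightarrow> P i j \<in> S"
  obtains A where "\<And>r k. r < p - 1 \<Longrightarrow> k < p \<Longrightarrow> A r k \<in> S"
    and "\<And>w. (\<forall>r<p-1. (\<Sum>k<p. A r k * w k) = 0) \<longleftrightarrow> (\<exists>\<beta>. \<forall>k<p. w k = \<beta> * v k)"
proof -
  \<comment> \<open>The number \<open>q\<close> of columns with eigenvalue \<open>n\<close> is shown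
    to equal \<open>p - 1\<close> only at the end, by two opposite dimension bounds.\<close>
  define Y where "Y = {j. j < n \<and> \<mu> j = n}"
  define q where "q = card Y"
  have "finite Y" by (simp add: Y_def)
  then obtain h where h: "bij_betw h {..<q} Y"
    unfolding q_def using ex_bij_betw_nat_finite[of Y] by (auto simp: atLeast0LessThan)
  have hY: "h r \<in> Y" if "r < q" for r using h that by (auto simp: bij_betw_def)
  have hn: "h r < n" "\<mu> (h r) = n" if "r < q" for r using hY[OF that] by (auto simp: Y_def)
  obtain rep where rep: "\<And>k. k < p \<Longrightarrow> rep k < n" "\<And>k. k < p \<Longrightarrow> c (rep k) = k"
    using c_surj by metis
  define A where "A = (\<lambda>r k. P (rep k) (h r))"
  have PA: "P i (h r) = A r (c i)" and vA: "(\<Sum>k<p. v k * A r k) = 0" if "r < q" "i < n" for r i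
  proof -
    from ev[OF _ hn(1)] hn(2) that have "\<And>i. i < n \<Longrightarrow> (\<Sum>k<n. m i k * P k (h r)) = real n * P i (h r)"
      by simp
    from eigenvector_m_n[OF this]
    obtain y where y: "\<And>i. i < n \<Longrightarrow> P i (h r) = y (c i)" "(\<Sum>k<p. v k * y k) = 0" by blast
    have Ay: "A r k = y k" if "k < p" for k using y(1) rep that by (simp add: A_def)
    then show "(\<Sum>k<p. v k * A r k) = 0" using y(2) by simp
    show "P i (h r) = A r (c i)" using y(1) Ay c_less that by simp
  qed
  \<comment> \<open>Rescaled by \<open>1 / v k\<close> and shifted by a constant, a kernel vector of \<open>A\<close> becomes a class
    function of sum zero that is orthogonal to every column of \<open>P\<close>, so it vanishes.\<close>
  have ker_span: "\<exists>\<beta>. \<forall>k<p. w k = \<beta> * v k" if w: "\<And>r. r < q \<Longrightarrow> (\<Sum>k<p. A r k * w k) = 0" for w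
  proof -
    \<comment> \<open>Since the class sizes add up to \<open>n\<close>, this constant gives
      \<open>u\<close> weighted sum zero.\<close>
    define \<beta> where "\<beta> = (\<Sum>k<p. w k) / n"
    define u where "u = (\<lambda>k. w k / v k - \<beta>)"
    have vu: "v k * u k = w k - \<beta> * v k" if "k < p" for k
      using v_pos[OF that] by (simp add: u_def field_simps)
    have sum_v: "(\<Sum>k<p. v k) = n" using sum_class[of "\<lambda>_. 1"] by simp
    have u0: "(\<Sum>k<p. v k * u k) = 0"
      using n_pos by (simp add: vu sum_subtractf sum_v flip: sum_distrib_left) (simp add: \<beta>_def)
    \<comment> \<open>For eigenvalue \<open>n\<close> this is the hypothesis on \<open>w\<close>;
      for any other eigenvalue it is orthogonality of eigenspaces.\<close>
    have orth: "(\<Sum>i<n. P i j * u (c i)) = 0" if j: "j < n" for j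
    proof (cases "\<mu> j = n")
      case True
      then have "j \<in> Y" using j by (simp add: Y_def)
      then obtain r where r: "r < q" "j = h r" using h by (auto simp: bij_betw_def)
      have "(\<Sum>i<n. P i j * u (c i)) = (\<Sum>i<n. A r (c i) * u (c i))"
        using PA[OF r(1)] r(2) by simp
      also have "\<dots> = (\<Sum>k<p. A r k * (v k * u k))"
        using sum_class[of "\<lambda>k. A r k * u k"] by (simp add: algebra_simps)
      also have "\<dots> = (\<Sum>k<p. A r k * (w k - \<beta> * v k))" by (simp add: vu)
      also have "\<dots> = (\<Sum>k<p. A r k * w k) - \<beta> * (\<Sum>k<p. v k * A r k)"
        by (simp add: algebra_simps sum_subtractf sum_distrib_left)
      finally show ?thesis using w[OF r(1)] vA[OF r(1) n_pos] by simp
    next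
      case False
      show ?thesis by (rule m_orthogonal[OF False _ u0]) (use ev j in simp)
    qed
    have "u (c i) = 0" if "i < n" for i
      by (rule trivial_kernelD[OF trivial_kernel_transpose_nat[OF tk], where f = "\<lambda>i. u (c i)"])
        (use orth that in auto)
    then have "w k = \<beta> * v k" if "k < p" for k
      using vu[OF that] rep that by (metis eq_iff_diff_eq_0 mult_zero_right)
    then show ?thesis by blast
  qed
  have vv: "(\<Sum>k<p. v k * v k) \<noteq> 0"
  proof -
    have "(\<Sum>k<p. v k * v k) > 0"
      by (rule sum_pos) (use v_pos p_pos in \<open>auto simp: lessThan_empty_iff\<close>)
    then show ?thesis by simp
  qed
  \<comment> \<open>First bound: a vector annihilated by \<open>A\<close> is a multiple of
    \<open>v\<close>, and pairing it with \<open>v\<close> itself forces the factor to be 0.\<close>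
  have "trivial_kernel {..<Suc q} {..<p} (\<lambda>r k. if r < q then A r k else v k)"
  proof (rule trivial_kernelI)
    fix f k
    assume zero: "\<And>r. r \<in> {..<Suc q} \<Longrightarrow> (\<Sum>k<p. (if r < q then A r k else v k) * f k) = 0"
      and k: "k \<in> {..<p}"
    have "(\<Sum>k<p. A r k * f k) = 0" if "r < q" for r using zero[of r] that by simp
    from ker_span[OF this] obtain \<beta> where \<beta>: "\<And>k. k < p \<Longrightarrow> f k = \<beta> * v k" by blast
    have "\<beta> * (\<Sum>k<p. v k * v k) = 0"
      using zero[of q] \<beta> by (simp add: sum_distrib_left algebra_simps)
    then show "f k = 0" using vv \<beta> k by simp
  qed
  from trivial_kernel_card_le[OF this] have "p \<le> Suc q" by simp
  \<comment> \<open>Second bound: the rows of \<open>A\<close> and \<open>v\<close> are independent.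
    Pairing a relation with \<open>v\<close> removes its last coefficient; the others form a
    relation between columns of \<open>P\<close>.\<close>
  moreover have "trivial_kernel {..<p} {..<Suc q} (\<lambda>k r. if r < q then A r k else v k)"
  proof (rule trivial_kernelI)
    fix f r
    assume "\<And>k. k \<in> {..<p} \<Longrightarrow> (\<Sum>r<Suc q. (if r < q then A r k else v k) * f r) = 0"
      and r: "r \<in> {..<Suc q}"
    then have zero: "(\<Sum>r<q. A r k * f r) + v k * f q = 0" if "k < p" for k using that by simp
    have "0 = (\<Sum>k<p. v k * ((\<Sum>r<q. A r k * f r) + v k * f q))" using zero by simp
    also have "\<dots> = (\<Sum>k<p. \<Sum>r<q. v k * A r k * f r) + f q * (\<Sum>k<p. v k * v k)"
      by (simp add: distrib_left sum.distrib sum_distrib_left algebra_simps)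
    also have "(\<Sum>k<p. \<Sum>r<q. v k * A r k * f r) = (\<Sum>r<q. \<Sum>k<p. v k * A r k * f r)"
      by (rule sum.swap)
    also have "\<dots> = (\<Sum>r<q. (\<Sum>k<p. v k * A r k) * f r)" by (simp add: sum_distrib_right)
    also have "\<dots> = 0" using vA[OF _ n_pos] by simp
    finally have fq: "f q = 0" using vv by simp
    \<comment> \<open>Extends the coefficients by zero to all columns of \<open>P\<close>, so that
      \<open>tk\<close> applies.\<close>
    define g where "g = (\<lambda>j. if j \<in> Y then f (inv_into {..<q} h j) else 0)"
    have gh: "g (h r) = f r" if "r < q" for r
      using hY[OF that] h that by (simp add: g_def bij_betw_inv_into_left)
    have "g j = 0" if "j < n" for j
    proof (rule trivial_kernelD[OF tk])
      fix i assume "i \<in> {..<n}"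
      then have i: "i < n" by simp
      have "(\<Sum>j<n. P i j * g j) = (\<Sum>j\<in>Y. P i j * g j)"
        by (rule sum.mono_neutral_right) (auto simp: Y_def g_def)
      also have "\<dots> = (\<Sum>r<q. P i (h r) * g (h r))" by (rule sum.reindex_bij_betw[OF h, symmetric])
      also have "\<dots> = (\<Sum>r<q. A r (c i) * f r)" using PA i gh by simp
      also have "\<dots> = 0" using zero[OF c_less[OF i]] fq by simp
      finally show "(\<Sum>j<n. P i j * g j) = 0" .
    qed (use that in simp)
    then show "f r = 0" using fq gh hn r by (metis lessThan_iff less_Suc_eq)
  qed
  from trivial_kernel_card_le[OF this] have "Suc q \<le> p" by simp
  ultimately have q: "q = p - 1" by simp
  show ?thesis
  proof
    show "A r k \<in> S" if "r < p - 1" "k < p" for r k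
      using S rep hn that q by (simp add: A_def)
    show "(\<forall>r<p-1. (\<Sum>k<p. A r k * w k) = 0) \<longleftrightarrow> (\<exists>\<beta>. \<forall>k<p. w k = \<beta> * v k)" for w
    proof
      assume "\<exists>\<beta>. \<forall>k<p. w k = \<beta> * v k"
      then obtain \<beta> where "\<forall>k<p. w k = \<beta> * v k" ..
      then have "(\<Sum>k<p. A r k * w k) = \<beta> * (\<Sum>k<p. v k * A r k)" for r
        by (simp add: sum_distrib_left algebra_simps)
      then show "\<forall>r<p-1. (\<Sum>k<p. A r k * w k) = 0" using vA[OF _ n_pos] q by simp
    qed (use ker_span q in blast)
  qed
qed

section \<open>From a balanced vector to an eigenbasis of \<open>m\<close> with banded Gram
  matrix\<close>

text \<open>The \<open>q + p\<close> new columns are independent, so \<open>q + p \<le> n\<close>.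
  At most \<open>p\<close> columns of \<open>P\<close> lie in the kernel of \<open>l\<close>, which
  gives the reverse inequality, so the family is a basis.\<close>

lemma complement_eigenbasis:
  fixes P A :: "nat \<Rightarrow> nat \<Rightarrow> real"
  assumes tk: "trivial_kernel {..<n} {..<n} P"
    and ev: "\<And>i j. i < n \<Longrightarrow> j < n \<Longrightarrow> (\<Sum>k<n. l i k * P k j) = d j * P i j"
    and S: "\<And>i j. i < n \<Longrightarrow> j < n \<Longrightarrow> P i j \<in> S" "1 \<in> S"
    and band: "0 < b" "\<And>i j. i < n \<Longrightarrow> j < n \<Longrightarrow> int b \<le> \<bar>int i - int j\<bar> \<Longrightarrow> (\<Sum>k<n. P k i * P k j) = 0"
    and AS: "\<And>r k. r < p - 1 \<Longrightarrow> k < p \<Longrightarrow> A r k \<in> S"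
    and Aker: "\<And>w. (\<forall>r<p-1. (\<Sum>k<p. A r k * w k) = 0) \<longleftrightarrow> (\<exists>\<beta>. \<forall>k<p. w k = \<beta> * v k)"
  obtains R \<mu> where "trivial_kernel {..<n} {..<n} R"
    and "\<And>i j. i < n \<Longrightarrow> j < n \<Longrightarrow> (\<Sum>k<n. m i k * R k j) = \<mu> j * R i j"
    and "\<And>i j. i < n \<Longrightarrow> j < n \<Longrightarrow> R i j \<in> S"
    and "\<And>i j. i < n \<Longrightarrow> j < n \<Longrightarrow> int (max (p - 1) b) \<le> \<bar>int i - int j\<bar> \<Longrightarrow>
           (\<Sum>k<n. R k i * R k j) = 0"
proof -
  \<comment> \<open>The new basis: the old eigenvectors off the kernel in their old order (deleting columns keeps
    the Gram matrix banded), then the rows of \<open>A\<close> spread over the classes, then the all-ones vector.\<close>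
  define js where "js = filter (\<lambda>j. d j \<noteq> 0) [0..<n]"
  define q where "q = length js"
  define h where "h = (!) js"
  have set_js: "set js = {j. j < n \<and> d j \<noteq> 0}" by (auto simp: js_def)
  have h: "bij_betw h {..<q} {j. j < n \<and> d j \<noteq> 0}"
    unfolding h_def q_def by (rule bij_betw_nth) (auto simp: js_def)
  have hn: "h r < n" "d (h r) \<noteq> 0" if "r < q" for r
    using h that by (auto simp: bij_betw_def)
  have sorted: "sorted_wrt (<) js" unfolding js_def by (rule sorted_wrt_filter) simp
  \<comment> \<open>As \<open>h\<close> is strictly increasing, columns far apart in
    \<open>R\<close> were at least as far apart in \<open>P\<close>.\<close>
  have h_gap: "int t - int s \<le> int (h t) - int (h s)" if "s \<le> t" "t < q" for s t
    using that
  proof (induction t rule: dec_induct)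
    case (step t)
    have "h t < h (Suc t)" unfolding h_def
      by (rule sorted_wrt_nth_less[OF sorted]) (use step in \<open>auto simp: q_def\<close>)
    then show ?case using step by simp
  qed simp
  \<comment> \<open>The default value makes \<open>B (p - 1)\<close> the all-ones vector.\<close>
  define B where "B = (\<lambda>s. if s < p - 1 then A s else (\<lambda>_. 1))"
  define R where "R = (\<lambda>i j. if j < q then P i (h j) else B (j - q) (c i))"
  \<comment> \<open>\<open>v\<close> itself is annihilated by \<open>A\<close>: the factor is
    1.\<close>
  have vA: "(\<Sum>k<p. v k * A r k) = 0" if "r < p - 1" for r
    using Aker[of v] that by (auto simp: mult.commute intro: exI[of _ 1])
  have orth: "(\<Sum>i<n. P i (h r) * y (c i)) = 0" if "r < q" for r y
    by (rule orthogonal_class[OF hn(2)[OF that]]) (use ev hn that in simp)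

  \<comment> \<open>\<open>v\<close> rather than the all-ones vector is appended here, because it
    spans the kernel of \<open>A\<close> and has nonzero inner product with itself.\<close>
  have ker0: "trivial_kernel {..<p} {..<p} (\<lambda>r k. if r < p - 1 then A r k else v k)"
  proof (rule trivial_kernelI)
    fix f k
    assume zero: "\<And>r. r \<in> {..<p} \<Longrightarrow> (\<Sum>k<p. (if r < p - 1 then A r k else v k) * f k) = 0"
      and k: "k \<in> {..<p}"
    have "(\<Sum>k<p. A r k * f k) = 0" if "r < p - 1" for r using zero[of r] that by simp
    then obtain \<beta> where \<beta>: "\<And>k. k < p \<Longrightarrow> f k = \<beta> * v k" using Aker by blast
    have "0 = (\<Sum>k<p. v k * f k)" using zero[of "p - 1"] p_pos by simp
    also have "\<dots> = \<beta> * (\<Sum>k<p. v k * v k)" using \<beta> by (simp add: sum_distrib_left algebra_simps)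
    finally have "\<beta> = 0 \<or> (\<Sum>k<p. v k * v k) = 0" by simp
    moreover have "(\<Sum>k<p. v k * v k) > 0"
      by (rule sum_pos) (use v_pos p_pos in \<open>auto simp: lessThan_empty_iff\<close>)
    ultimately show "f k = 0" using \<beta> k by simp
  qed
  \<comment> \<open>Pairing a relation with \<open>v\<close> annihilates the rows of
    \<open>A\<close> and leaves \<open>n\<close> times the last coefficient. Once that is 0, the
    transpose of \<open>ker0\<close> yields the rest.\<close>
  have B_ker: "f s = 0" if zero: "\<And>k. k < p \<Longrightarrow> (\<Sum>s<p. B s k * f s) = 0" and s: "s < p" for f s
  proof -
    have split: "(\<Sum>s<p. g s) = (\<Sum>s<p-1. g s) + g (p - 1)" for g :: "nat \<Rightarrow> real"
      using p_pos sum.lessThan_Suc[of g "p - 1"] by simp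
    have zero': "(\<Sum>s<p-1. A s k * f s) + f (p - 1) = 0" if "k < p" for k
      using zero[OF that] unfolding split by (simp add: B_def)
    have "0 = (\<Sum>k<p. v k * ((\<Sum>s<p-1. A s k * f s) + f (p - 1)))" using zero' by simp
    also have "\<dots> = (\<Sum>k<p. \<Sum>s<p-1. v k * A s k * f s) + f (p - 1) * (\<Sum>k<p. v k)"
      by (simp add: distrib_left sum.distrib sum_distrib_left algebra_simps)
    also have "(\<Sum>k<p. \<Sum>s<p-1. v k * A s k * f s) = (\<Sum>s<p-1. \<Sum>k<p. v k * A s k * f s)"
      by (rule sum.swap)
    also have "\<dots> = (\<Sum>s<p-1. (\<Sum>k<p. v k * A s k) * f s)" by (simp add: sum_distrib_right)
    also have "\<dots> = 0" using vA by simp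
    finally have last: "f (p - 1) = 0" using sum_class[of "\<lambda>_. 1"] n_pos by simp
    let ?g = "\<lambda>s. if s < p - 1 then f s else 0"
    have "?g s = 0"
    proof (rule trivial_kernelD[OF trivial_kernel_transpose_nat[OF ker0]])
      show "(\<Sum>j<p. (if j < p - 1 then A j i else v i) * ?g j) = 0" if "i \<in> {..<p}" for i
        unfolding split using zero'[of i] that last by simp
    qed (use s in simp)
    then show ?thesis using last s p_pos
      by (metis Suc_pred' One_nat_def Suc_le_eq less_SucE)
  qed

  \<comment> \<open>A relation reads \<open>u + w \<circ> c = 0\<close> with \<open>u\<close>
    spanned by old eigenvectors off the kernel. The two parts are orthogonal, so both
    vanish.\<close>
  have inj: "trivial_kernel {..<n} {..<q + p} R"
  proof (rule trivial_kernelI)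
    fix f j
    assume zero0: "\<And>i. i \<in> {..<n} \<Longrightarrow> (\<Sum>j<q + p. R i j * f j) = 0" and j: "j \<in> {..<q + p}"
    define u where "u = (\<lambda>i. \<Sum>r<q. P i (h r) * f r)"
    define w where "w = (\<lambda>k. \<Sum>s<p. B s k * f (q + s))"
    have split: "(\<Sum>j<q + p. g j) = (\<Sum>j<q. g j) + (\<Sum>s<p. g (q + s))" for g :: "nat \<Rightarrow> real"
      by (induction p) simp_all
    have uw: "u i + w (c i) = 0" if "i < n" for i
      using zero0[of i] that unfolding split by (simp add: R_def u_def w_def)
    have "(\<Sum>i<n. u i * w (c i)) = (\<Sum>i<n. \<Sum>r<q. f r * (P i (h r) * w (c i)))"
      by (simp add: u_def sum_distrib_left sum_distrib_right algebra_simps)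
    also have "\<dots> = (\<Sum>r<q. \<Sum>i<n. f r * (P i (h r) * w (c i)))" by (rule sum.swap)
    also have "\<dots> = 0" using orth by (simp flip: sum_distrib_left)
    finally have "(\<Sum>i<n. u i * w (c i)) = 0" .
    moreover have "u i * w (c i) = - (w (c i) * w (c i))" if "i < n" for i
      using uw[OF that] by (simp add: eq_neg_iff_add_eq_0[symmetric])
    ultimately have "(\<Sum>i<n. w (c i) * w (c i)) = 0" by (simp add: sum_negf)
    then have wc: "w (c i) = 0" if "i < n" for i
      using that by (subst (asm) sum_nonneg_eq_0_iff) auto
    then have "w k = 0" if "k < p" for k using c_surj[OF that] by blast
    then have fs: "f (q + s) = 0" if "s < p" for s
      using B_ker[of "\<lambda>s. f (q + s)"] that unfolding w_def by blast
    define g where "g = (\<lambda>j. if d j \<noteq> 0 then f (inv_into {..<q} h j) else 0)"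
    have gh: "g (h r) = f r" if "r < q" for r
      using hn[OF that] h that by (simp add: g_def bij_betw_inv_into_left)
    have "g j = 0" if "j < n" for j
    proof (rule trivial_kernelD[OF tk])
      fix i assume "i \<in> {..<n}"
      then have i: "i < n" by simp
      have "(\<Sum>j<n. P i j * g j) = (\<Sum>j | j < n \<and> d j \<noteq> 0. P i j * g j)"
        by (rule sum.mono_neutral_right) (auto simp: g_def)
      also have "\<dots> = (\<Sum>r<q. P i (h r) * g (h r))" by (rule sum.reindex_bij_betw[OF h, symmetric])
      also have "\<dots> = u i" using gh by (simp add: u_def)
      also have "\<dots> = 0" using uw[OF i] wc[OF i] by simp
      finally show "(\<Sum>j<n. P i j * g j) = 0" .
    qed (use that in simp)
    then have "f r = 0" if "r < q" for r using gh hn that by metis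
    then show "f j = 0" using fs[of "j - q"] j by (cases "j < q") auto
  qed

  \<comment> \<open>The kernel columns of \<open>P\<close> are independent class functions,
    determined by \<open>p\<close> representatives, so there are at most \<open>p\<close> of
    them.\<close>
  define Z where "Z = {j. j < n \<and> d j = 0}"
  obtain rep where rep: "\<And>k. k < p \<Longrightarrow> rep k < n" "\<And>k. k < p \<Longrightarrow> c (rep k) = k"
    using c_surj by metis
  have Z_class: "P i j = P (rep (c i)) j" if "j \<in> Z" "i < n" for i j
  proof -
    from that ev have "\<forall>i<n. (\<Sum>k<n. l i k * P k j) = 0" by (simp add: Z_def)
    then obtain y where "\<forall>i<n. P i j = y (c i)" using kernel_iff[of "\<lambda>k. P k j"] by blast
    then show ?thesis using rep c_less that by simp
  qed
  have "trivial_kernel {..<p} Z (\<lambda>k j. P (rep k) j)"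
  proof (rule trivial_kernelI)
    fix f j
    assume zero: "\<And>k. k \<in> {..<p} \<Longrightarrow> (\<Sum>j\<in>Z. P (rep k) j * f j) = 0" and j: "j \<in> Z"
    let ?g = "\<lambda>j. if j \<in> Z then f j else 0"
    have "?g j = 0"
    proof (rule trivial_kernelD[OF tk])
      fix i assume "i \<in> {..<n}"
      then have i: "i < n" by simp
      have "(\<Sum>j<n. P i j * ?g j) = (\<Sum>j\<in>Z. P i j * ?g j)"
        by (rule sum.mono_neutral_right) (auto simp: Z_def)
      also have "\<dots> = (\<Sum>j\<in>Z. P (rep (c i)) j * f j)"
        using Z_class i by (intro sum.cong) auto
      also have "\<dots> = 0" using zero c_less[OF i] by simp
      finally show "(\<Sum>j<n. P i j * ?g j) = 0" .
    qed (use j in \<open>auto simp: Z_def\<close>)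
    then show "f j = 0" using j by simp
  qed
  from trivial_kernel_card_le[OF this] have "card Z \<le> p" by (simp add: Z_def)
  moreover have "q = card {j. j < n \<and> d j \<noteq> 0}" using bij_betw_same_card[OF h] by simp
  moreover have "card {j. j < n \<and> d j \<noteq> 0} + card Z = n"
  proof -
    have "card {j. j < n \<and> d j \<noteq> 0} + card Z = card ({j. j < n \<and> d j \<noteq> 0} \<union> Z)"
      by (rule card_Un_disjoint[symmetric]) (auto simp: Z_def)
    also have "{j. j < n \<and> d j \<noteq> 0} \<union> Z = {..<n}" by (auto simp: Z_def)
    finally show ?thesis by simp
  qed
  moreover from trivial_kernel_card_le[OF inj] have "q + p \<le> n" by simp
  ultimately have qp: "q + p = n" by simp

  \<comment> \<open>Eigenvalue \<open>n - d\<close> for an old column, \<open>n\<close> for a row of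
    \<open>A\<close>, and 0 for the all-ones vector.\<close>
  define \<mu> where "\<mu> = (\<lambda>j. if j < q then n - d (h j) else if j < q + (p - 1) then real n else 0)"
  show ?thesis
  proof
    show "trivial_kernel {..<n} {..<n} R" using inj qp by simp
    show "R i j \<in> S" if "i < n" "j < n" for i j
      using S AS hn c_less that qp by (simp add: R_def B_def)
    show "(\<Sum>k<n. m i k * R k j) = \<mu> j * R i j" if "i < n" "j < n" for i j
    proof -
      consider "j < q" | "q \<le> j" "j - q < p - 1" | "q \<le> j" "\<not> j - q < p - 1" by linarith
      then show ?thesis
      proof cases
        case 1
        with m_eigenvector[OF hn(2)[OF 1], of "\<lambda>i. P i (h j)" i] ev hn that
        show ?thesis by (simp add: R_def \<mu>_def)
      next
        case 2
        with m_class[OF that(1) vA[OF 2(2)]] show ?thesis by (simp add: R_def B_def \<mu>_def)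
      next
        case 3
        with m_apply[OF that(1), of "\<lambda>_. 1"] l_row_sum[OF that(1)] that
        show ?thesis by (auto simp: R_def B_def \<mu>_def)
      qed
    qed
    have gram: "(\<Sum>k<n. R k i * R k j) = 0"
      if ij: "i \<le> j" "j < n" "int (max (p - 1) b) \<le> int j - int i" for i j
    proof -
      consider "j < q" | "i < q" "q \<le> j" | "q \<le> i" by linarith
      then show ?thesis
      proof cases
        case 1
        then have "int b \<le> \<bar>int (h i) - int (h j)\<bar>" using h_gap[OF ij(1) 1] ij(3) by simp
        from band(2)[OF _ _ this] hn 1 ij(1) show ?thesis by (simp add: R_def)
      next
        case 2
        then show ?thesis using orth[OF 2(1), of "B (j - q)"] by (simp add: R_def)
      next
        case 3
        \<comment> \<open>Among the last \<open>p\<close> columns, distance \<open>p - 1\<close>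
          leaves only the first row of \<open>A\<close> against the all-ones vector, orthogonal by
          \<open>vA\<close>. For \<open>p = 1\<close>, positivity of \<open>b\<close> excludes the
          diagonal entry.\<close>
        then have i: "i - q < p - 1" and j: "j - q = p - 1" using ij qp band(1) by auto
        then show ?thesis using 3 ij(1) vA[OF i] sum_class[of "A (i - q)"]
          by (simp add: R_def B_def)
      qed
    qed
    show "(\<Sum>k<n. R k i * R k j) = 0"
      if "i < n" "j < n" "int (max (p - 1) b) \<le> \<bar>int i - int j\<bar>" for i j
      using gram[of i j] gram[of j i] that by (cases "i \<le> j") (auto simp: mult.commute)
  qed
qed

end

section \<open>The Laplacian of a graph and of its complement\<close>

lemma laplacian_carrier: "laplacian vs G \<in> carrier_mat (length vs) (length vs)"
  by (simp add: laplacian_def degree_mat_def adjacency_mat_def minus_carrier_mat)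

text \<open>Writes the degree as a row sum of adjacencies. Arcs need only stay within
  \<open>vs\<close>, so the formula serves a graph and its complement alike.\<close>

lemma laplacian_index:
  assumes "distinct vs" "parcs G \<subseteq> set vs \<times> set vs" "i < length vs" "j < length vs"
  shows "laplacian vs G $$ (i, j) =
    (if i = j then \<Sum>k<length vs. of_bool ((vs ! i, vs ! k) \<in> parcs G) else 0)
      - of_bool ((vs ! i, vs ! j) \<in> parcs G)"
proof -
  have "out_arcs (with_proj G) (vs ! i) = (\<lambda>k. (vs ! i, vs ! k)) ` {k. k < length vs \<and> (vs ! i, vs ! k) \<in> parcs G}"
    using assms(2) by (fastforce simp: in_set_conv_nth out_arcs_def)
  moreover have "inj_on (\<lambda>k. (vs ! i, vs ! k)) {k. k < length vs \<and> (vs ! i, vs ! k) \<in> parcs G}"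
    using assms(1) by (auto simp: inj_on_def nth_eq_iff_index_eq)
  ultimately have "out_degree (with_proj G) (vs ! i) = card {k. k < length vs \<and> (vs ! i, vs ! k) \<in> parcs G}"
    by (simp add: out_degree_def card_image)
  also have "real \<dots> = (\<Sum>k<length vs. of_bool ((vs ! i, vs ! k) \<in> parcs G))"
    by (simp add: of_bool_def sum.If_cases Int_def)
  finally show ?thesis
    using assms(3,4) by (auto simp: laplacian_def degree_mat_def adjacency_mat_def mat_diag_def)
qed

text \<open>Without loops the adjacency matrix of the complement is \<open>J - I - A\<close>, and
  its row sums turn a degree \<open>d\<close> into \<open>n - 1 - d\<close>.\<close>

lemma laplacian_complement_index:
  assumes "distinct vs" "pair_graph G" "set vs = pverts G" "i < length vs" "j < length vs"
  shows "laplacian vs (complement G) $$ (i, j) =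
    (if i = j then real (length vs) else 0) - 1 - laplacian vs G $$ (i, j)"
proof -
  interpret pair_graph G by fact
  have sub: "parcs G \<subseteq> set vs \<times> set vs" "parcs (complement G) \<subseteq> set vs \<times> set vs"
    using assms(3) in_arcsD1 in_arcsD2 by (auto simp: complement_def)
  have c: "of_bool ((vs ! i, vs ! k) \<in> parcs (complement G)) =
      1 - of_bool (i = k) - (of_bool ((vs ! i, vs ! k) \<in> parcs G) :: real)"
    if "i < length vs" "k < length vs" for i k
    using that assms(1) nth_mem[OF that(1)] nth_mem[OF that(2)] no_loops'
    unfolding assms(3) by (auto simp: complement_def nth_eq_iff_index_eq)
  have "(\<Sum>k<length vs. of_bool ((vs ! i, vs ! k) \<in> parcs (complement G))) =
      (\<Sum>k<length vs. 1 - of_bool (i = k) - (of_bool ((vs ! i, vs ! k) \<in> parcs G) :: real))"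
    using c[OF assms(4)] by (intro sum.cong) auto
  also have "\<dots> = real (length vs) - (\<Sum>k<length vs. of_bool (i = k))
      - (\<Sum>k<length vs. of_bool ((vs ! i, vs ! k) \<in> parcs G))"
    by (simp add: sum_subtractf)
  also have "(\<Sum>k<length vs. of_bool (i = k)) = (1 :: real)"
    using assms(4) by (simp add: of_bool_def)
  finally show ?thesis
    unfolding laplacian_index[OF assms(1) sub(1) assms(4,5)] laplacian_index[OF assms(1) sub(2) assms(4,5)]
      c[OF assms(4,5)]
    by (cases "i = j") simp_all
qed

lemma (in pair_graph) laplacian_sym:
  assumes "distinct vs" "set vs = pverts G" "i < length vs" "j < length vs"
  shows "laplacian vs G $$ (i, j) = laplacian vs G $$ (j, i)"
proof -
  have "parcs G \<subseteq> set vs \<times> set vs" using assms(2) in_arcsD1 in_arcsD2 by auto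
  then show ?thesis
    using assms arcs_symmetric by (auto simp: laplacian_index)
qed

text \<open>The quadratic form of the Laplacian is half the sum of
  \<open>a i j * (x i - x j)\<^sup>2\<close> over ordered pairs. It vanishes on the kernel, and then
  so does each term.\<close>

lemma (in pair_graph) laplacian_kernel:
  assumes vs: "distinct vs" "set vs = pverts G"
  shows "(\<forall>i<length vs. (\<Sum>j<length vs. laplacian vs G $$ (i, j) * x j) = 0) \<longleftrightarrow>
    (\<forall>i<length vs. \<forall>j<length vs. (vs ! i, vs ! j) \<in> parcs G \<longrightarrow> x i = x j)"
proof -
  let ?n = "length vs"
  define a where "a = (\<lambda>i j. of_bool ((vs ! i, vs ! j) \<in> parcs G) :: real)"
  have sub: "parcs G \<subseteq> set vs \<times> set vs" using vs(2) in_arcsD1 in_arcsD2 by auto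
  have a_sym: "a i j = a j i" for i j using arcs_symmetric by (auto simp: a_def)
  have laplacian_apply: "(\<Sum>j<?n. laplacian vs G $$ (i, j) * x j) = (\<Sum>j<?n. a i j * (x i - x j))"
    if "i < ?n" for i
  proof -
    have "(\<Sum>j<?n. laplacian vs G $$ (i, j) * x j) =
        (\<Sum>j<?n. (if i = j then (\<Sum>k<?n. a i k) * x i else 0) - a i j * x j)"
      using that by (intro sum.cong) (auto simp: laplacian_index[OF vs(1) sub] a_def left_diff_distrib)
    also have "\<dots> = (\<Sum>k<?n. a i k) * x i - (\<Sum>j<?n. a i j * x j)"
      using that by (simp add: sum_subtractf)
    finally show ?thesis by (simp add: right_diff_distrib sum_subtractf sum_distrib_right)
  qed
  show ?thesis
  proof
    assume zero: "\<forall>i<?n. (\<Sum>j<?n. laplacian vs G $$ (i, j) * x j) = 0"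
    have "0 = (\<Sum>i<?n. x i * (\<Sum>j<?n. a i j * (x i - x j)))" using zero laplacian_apply by simp
    also have "\<dots> = (\<Sum>i<?n. \<Sum>j<?n. a i j * (x i - x j) * x i)"
      by (simp add: sum_distrib_left mult.commute)
    finally have 1: "(\<Sum>i<?n. \<Sum>j<?n. a i j * (x i - x j) * x i) = 0" by simp
    \<comment> \<open>Exchanging the roles of \<open>i\<close> and \<open>j\<close> gives a twin of
      fact \<open>1\<close>; the two add up to the sum of squares.\<close>
    have "(\<Sum>i<?n. \<Sum>j<?n. a i j * (x i - x j) * x i) = (\<Sum>j<?n. \<Sum>i<?n. a i j * (x i - x j) * x i)"
      by (rule sum.swap)
    then have 2: "(\<Sum>i<?n. \<Sum>j<?n. a i j * (x j - x i) * x j) = 0"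
      using 1 a_sym by simp
    have "(\<Sum>i<?n. \<Sum>j<?n. a i j * (x i - x j)\<^sup>2) =
       (\<Sum>i<?n. \<Sum>j<?n. a i j * (x i - x j) * x i) + (\<Sum>i<?n. \<Sum>j<?n. a i j * (x j - x i) * x j)"
      by (simp add: power2_eq_square algebra_simps flip: sum.distrib)
    then have sq: "(\<Sum>i<?n. \<Sum>j<?n. a i j * (x i - x j)\<^sup>2) = 0" using 1 2 by simp
    have nonneg: "0 \<le> a i j * (x i - x j)\<^sup>2" for i j by (simp add: a_def)
    have "a i j * (x i - x j)\<^sup>2 = 0" if "i < ?n" "j < ?n" for i j
    proof -
      have "(\<Sum>j<?n. a i j * (x i - x j)\<^sup>2) = 0"
        using sq that(1) nonneg by (subst (asm) sum_nonneg_eq_0_iff) (auto intro: sum_nonneg)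
      then show ?thesis using that(2) nonneg by (subst (asm) sum_nonneg_eq_0_iff) auto
    qed
    then show "\<forall>i<?n. \<forall>j<?n. (vs ! i, vs ! j) \<in> parcs G \<longrightarrow> x i = x j" by (auto simp: a_def)
  next
    assume "\<forall>i<?n. \<forall>j<?n. (vs ! i, vs ! j) \<in> parcs G \<longrightarrow> x i = x j"
    then have "a i j * (x i - x j) = 0" if "i < ?n" "j < ?n" for i j using that by (auto simp: a_def)
    then show "\<forall>i<?n. (\<Sum>j<?n. laplacian vs G $$ (i, j) * x j) = 0"
      by (auto simp: laplacian_apply intro!: sum.neutral)
  qed
qed

section \<open>Connected components as classes of vertex positions\<close>

lemma (in pair_graph) components_eq: "components G = {scc_of u | u. u \<in> pverts G}"
  unfolding components_def using sccs_verts_conv_scc_of by auto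

text \<open>Equality along arcs spreads along paths; conversely, symmetry of the arcs puts both ends
  of an arc into one strongly connected component.\<close>

lemma (in pair_graph) arc_invariant_iff_component_invariant:
  "(\<forall>u w. (u, w) \<in> parcs G \<longrightarrow> f u = f w) \<longleftrightarrow>
   (\<forall>C\<in>components G. \<forall>u\<in>C. \<forall>w\<in>C. f u = f w)"
proof
  assume arc: "\<forall>u w. (u, w) \<in> parcs G \<longrightarrow> f u = f w"
  have reach: "f u = f w" if "u \<rightarrow>\<^sup>*\<^bsub>with_proj G\<^esub> w" for u w
    using that by (induction rule: reachable_induct) (use arc in auto)
  show "\<forall>C\<in>components G. \<forall>u\<in>C. \<forall>w\<in>C. f u = f w"
    unfolding components_def sccs_verts_def using reach by blast
next
  assume comp: "\<forall>C\<in>components G. \<forall>u\<in>C. \<forall>w\<in>C. f u = f w"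
  show "\<forall>u w. (u, w) \<in> parcs G \<longrightarrow> f u = f w"
  proof (intro allI impI)
    fix u w assume uw: "(u, w) \<in> parcs G"
    then have "u \<rightarrow>\<^sup>*\<^bsub>with_proj G\<^esub> w" by auto
    then have "u \<in> scc_of w" by (rule scc_ofI_reachable)
    moreover have "w \<in> scc_of w" using uw in_arcsD2 in_scc_of_self by simp
    moreover have "scc_of w \<in> components G" using uw in_arcsD2 by (auto simp: components_eq)
    ultimately show "f u = f w" using comp by blast
  qed
qed

text \<open>For a vertex the choice is unique when \<open>Cs\<close> lists each component once,
  since components are disjoint; outside the vertices the value is unspecified.\<close>

definition component_index :: "'a set list \<Rightarrow> 'a \<Rightarrow> nat" where
  "component_index Cs u = (SOME k. k < length Cs \<and> u \<in> Cs ! k)"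

context pair_graph
begin

lemma component_index_eq:
  assumes "distinct Cs" "set Cs = components G" "k < length Cs" "u \<in> Cs ! k"
  shows "component_index Cs u = k"
  unfolding component_index_def
proof (rule some_equality)
  fix k' assume k': "k' < length Cs \<and> u \<in> Cs ! k'"
  then have "Cs ! k \<in> components G" "Cs ! k' \<in> components G"
    using assms(2,3) nth_mem by blast+
  with k' assms(4) sccs_verts_disjoint have "Cs ! k = Cs ! k'" unfolding components_def by blast
  then show "k' = k" using assms(1,3) k' nth_eq_iff_index_eq by metis
qed (use assms in simp)

lemma component_index:
  assumes "set Cs = components G" "u \<in> pverts G"
  shows "component_index Cs u < length Cs" "u \<in> Cs ! component_index Cs u"
proof -
  have "scc_of u \<in> set Cs" "u \<in> scc_of u"
    using assms in_scc_of_self by (auto simp: components_eq)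
  then have "\<exists>k. k < length Cs \<and> u \<in> Cs ! k" by (metis in_set_conv_nth)
  from someI_ex[OF this] show "component_index Cs u < length Cs" "u \<in> Cs ! component_index Cs u"
    unfolding component_index_def by blast+
qed

lemma component_subset:
  assumes "C \<in> components G"
  shows "C \<subseteq> pverts G" "C \<noteq> {}"
  using assms sccs_verts_subsets in_sccs_verts_conv_reachable unfolding components_def by auto

text \<open>The kernel condition passes through a chain of equivalences: constant on arcs, constant
  on components, a function of the component index.\<close>

lemma class_matrix_laplacian:
  assumes vs: "distinct vs" "set vs = pverts G" "pverts G \<noteq> {}"
    and Cs: "distinct Cs" "set Cs = components G"
  shows "class_matrix (length vs) (length Cs) (\<lambda>i j. laplacian vs G $$ (i, j))
    (\<lambda>i. component_index Cs (vs ! i))"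
proof
  let ?c = "component_index Cs"
  have vs_nth: "vs ! i \<in> pverts G" if "i < length vs" for i using vs(2) nth_mem[OF that] by simp
  show "0 < length vs" using vs by auto
  show "laplacian vs G $$ (i, j) = laplacian vs G $$ (j, i)" if "i < length vs" "j < length vs" for i j
    by (rule laplacian_sym[OF vs(1,2) that])
  show "?c (vs ! i) < length Cs" if "i < length vs" for i
    by (rule component_index(1)[OF Cs(2) vs_nth[OF that]])
  show "\<exists>i<length vs. ?c (vs ! i) = k" if k: "k < length Cs" for k
  proof -
    have "Cs ! k \<in> components G" using nth_mem[OF k] Cs(2) by simp
    from component_subset[OF this] obtain u where "u \<in> Cs ! k" "u \<in> set vs" using vs(2) by auto
    then show ?thesis using component_index_eq[OF Cs k] by (metis in_set_conv_nth)
  qed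
  show "(\<forall>i<length vs. (\<Sum>j<length vs. laplacian vs G $$ (i, j) * x j) = 0) \<longleftrightarrow>
      (\<exists>y. \<forall>i<length vs. x i = y (?c (vs ! i)))" for x
  proof -
    \<comment> \<open>Transports \<open>x\<close> from positions to vertices.\<close>
    define f where "f = (\<lambda>u. x (inv_into {..<length vs} ((!) vs) u))"
    have fx: "f (vs ! i) = x i" if "i < length vs" for i
      unfolding f_def using vs(1) that by (simp add: inv_into_f_f inj_on_def nth_eq_iff_index_eq)
    have "(\<forall>i<length vs. (\<Sum>j<length vs. laplacian vs G $$ (i, j) * x j) = 0) \<longleftrightarrow>
        (\<forall>i<length vs. \<forall>j<length vs. (vs ! i, vs ! j) \<in> parcs G \<longrightarrow> f (vs ! i) = f (vs ! j))"
      unfolding laplacian_kernel[OF vs(1,2)] using fx by simp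
    also have "\<dots> \<longleftrightarrow> (\<forall>u w. (u, w) \<in> parcs G \<longrightarrow> f u = f w)"
      using in_arcsD1 in_arcsD2 vs(2) by (metis in_set_conv_nth)
    also have "\<dots> \<longleftrightarrow> (\<forall>C\<in>components G. \<forall>u\<in>C. \<forall>w\<in>C. f u = f w)"
      by (rule arc_invariant_iff_component_invariant)
    also have "\<dots> \<longleftrightarrow> (\<exists>y. \<forall>u\<in>pverts G. f u = y (?c u))"
    proof
      assume comp: "\<forall>C\<in>components G. \<forall>u\<in>C. \<forall>w\<in>C. f u = f w"
      have "f u = f (SOME w. w \<in> Cs ! ?c u)" if "u \<in> pverts G" for u
      proof -
        have "Cs ! ?c u \<in> components G"
          using component_index(1)[OF Cs(2) that] Cs(2) nth_mem by blast
        moreover have "u \<in> Cs ! ?c u" by (rule component_index(2)[OF Cs(2) that])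
        ultimately show ?thesis using comp by (metis someI)
      qed
      then show "\<exists>y. \<forall>u\<in>pverts G. f u = y (?c u)"
        by (intro exI[of _ "\<lambda>k. f (SOME w. w \<in> Cs ! k)"]) simp
    next
      assume "\<exists>y. \<forall>u\<in>pverts G. f u = y (?c u)"
      then obtain y where y: "\<And>u. u \<in> pverts G \<Longrightarrow> f u = y (?c u)" by blast
      show "\<forall>C\<in>components G. \<forall>u\<in>C. \<forall>w\<in>C. f u = f w"
      proof (intro ballI)
        fix C u w assume C: "C \<in> components G" "u \<in> C" "w \<in> C"
        then obtain k where k: "k < length Cs" "C = Cs ! k" using Cs(2) by (metis in_set_conv_nth)
        then have "?c u = k" "?c w = k" using component_index_eq[OF Cs] C by auto
        moreover have "u \<in> pverts G" "w \<in> pverts G" using component_subset(1)[OF C(1)] C(2,3) by auto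
        ultimately show "f u = f w" using y by metis
      qed
    qed
    also have "\<dots> \<longleftrightarrow> (\<exists>y. \<forall>i<length vs. x i = y (?c (vs ! i)))"
      using fx vs(2) by (metis in_set_conv_nth)
    finally show ?thesis .
  qed
qed

text \<open>Identifies the class sizes of the locale with the component sizes in the theorem:
  \<open>vs\<close> maps the positions of a class bijectively onto the component.\<close>

lemma card_component:
  assumes vs: "distinct vs" "set vs = pverts G"
    and Cs: "distinct Cs" "set Cs = components G" and k: "k < length Cs"
  shows "card {i. i < length vs \<and> component_index Cs (vs ! i) = k} = card (Cs ! k)"
proof -
  have "Cs ! k \<subseteq> set vs" using component_subset(1) nth_mem[OF k] Cs(2) vs(2) by auto
  moreover have "u \<in> Cs ! k \<longleftrightarrow> component_index Cs u = k" if "u \<in> set vs" for u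
    using component_index(2)[OF Cs(2)] component_index_eq[OF Cs k] that vs(2) by auto
  ultimately have "Cs ! k = (!) vs ` {i. i < length vs \<and> component_index Cs (vs ! i) = k}"
    by (auto simp: in_set_conv_nth image_iff subset_iff) metis
  moreover have "inj_on ((!) vs) {i. i < length vs \<and> component_index Cs (vs ! i) = k}"
    using vs(1) by (auto simp: inj_on_def nth_eq_iff_index_eq)
  ultimately show ?thesis by (simp add: card_image)
qed

end

section \<open>The criterion for complements and the bandwidth bound\<close>

theorem theorem4p8:
  fixes G :: "'a pair_pre_digraph"
    and vs :: "'a list"
    and Cs :: "'a set list"
    and p :: nat
    and v :: "real vec"
  assumes "pair_graph G"
    and "pverts G \<noteq> {}"
    and "distinct vs" and "set vs = pverts G"
    and "distinct Cs" and "set Cs = components G"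
    and "p = length Cs"
    and "v = vec p (\<lambda>i. real (card (Cs ! i)))"
    and "diagonalizable {-1, 0, 1} vs G"
  shows "(diagonalizable {-1, 0, 1} vs (complement G) \<longleftrightarrow> balanced v) \<and>
         (\<forall>k. balanced v \<longrightarrow> bandwidth {-1, 0, 1} vs G = enat k \<longrightarrow>
              bandwidth {-1, 0, 1} vs (complement G) \<le> enat (max (p - 1) k))"
proof -
  let ?S = "{-1, 0, 1} :: real set" and ?n = "length vs"
  let ?L = "laplacian vs G" and ?M = "laplacian vs (complement G)"
  interpret G: pair_graph G by fact
  interpret C: class_matrix ?n p "\<lambda>i j. ?L $$ (i, j)" "\<lambda>i. component_index Cs (vs ! i)"
    unfolding assms(7) by (rule G.class_matrix_laplacian) fact+
  have M: "?M $$ (i, j) = C.m i j" if "i < ?n" "j < ?n" for i j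
    unfolding C.m_def by (rule laplacian_complement_index[OF assms(3,1,4) that])
  have v: "v = vec p C.v"
    unfolding assms(8) C.v_def using G.card_component[OF assms(3-6)] assms(7) by (intro eq_vecI) auto
  have bal: "balanced v \<longleftrightarrow> (\<exists>A::nat \<Rightarrow> nat \<Rightarrow> real. (\<forall>r<p-1. \<forall>k<p. A r k \<in> ?S) \<and>
      (\<forall>w. (\<forall>r<p-1. (\<Sum>k<p. A r k * w k) = 0) \<longleftrightarrow> (\<exists>\<beta>. \<forall>k<p. w k = \<beta> * C.v k)))"
    unfolding v by (rule balanced_iff) (use C.p_pos C.v_pos in fastforce)+
  have balanced: "balanced v" if "diagonalizes ?S P ?M" for P
  proof -
    from that obtain \<mu> where P: "P \<in> carrier_mat ?n ?n" "elements_mat P \<subseteq> ?S"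
      "trivial_kernel {..<?n} {..<?n} (\<lambda>i j. P $$ (i, j))"
      "\<And>i j. i < ?n \<Longrightarrow> j < ?n \<Longrightarrow> (\<Sum>k<?n. ?M $$ (i, k) * P $$ (k, j)) = \<mu> j * P $$ (i, j)"
      unfolding diagonalizes_iff[OF laplacian_carrier] by blast
    have S: "P $$ (i, j) \<in> ?S" if "i < ?n" "j < ?n" for i j
      using elements_matI[OF P(1) that refl] P(2) by blast
    show ?thesis
      unfolding bal
      by (rule C.balanced_of_eigenbasis[OF P(3), where \<mu> = \<mu> and S = ?S]) (use P(4) S M in auto)
  qed
  \<comment> \<open>Stated for every diagonalizing \<open>P\<close> together with the bandwidth, so
    that it yields both the converse implication and, for an optimal \<open>P\<close>, the
    bound.\<close>
  have complement: "\<exists>R. diagonalizes ?S R ?M \<and> mat_bandwidth (R\<^sup>T * R) \<le> max (p - 1) (mat_bandwidth (P\<^sup>T * P))"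
    if "balanced v" "diagonalizes ?S P ?L" for P
  proof -
    let ?b = "mat_bandwidth (P\<^sup>T * P)"
    have gram: "(X\<^sup>T * X) $$ (i, j) = (\<Sum>k<?n. X $$ (k, i) * X $$ (k, j))"
      if "X \<in> carrier_mat ?n ?n" "i < ?n" "j < ?n" for X :: "real mat" and i j
      using mult_mat_eq_sum[OF transpose_carrier_mat[THEN iffD2, OF that(1)] that] that by simp
    from that(2) obtain d where P: "P \<in> carrier_mat ?n ?n" "elements_mat P \<subseteq> ?S"
      "trivial_kernel {..<?n} {..<?n} (\<lambda>i j. P $$ (i, j))"
      "\<And>i j. i < ?n \<Longrightarrow> j < ?n \<Longrightarrow> (\<Sum>k<?n. ?L $$ (i, k) * P $$ (k, j)) = d j * P $$ (i, j)"
      unfolding diagonalizes_iff[OF laplacian_carrier] by blast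
    have S: "P $$ (i, j) \<in> ?S" if "i < ?n" "j < ?n" for i j
      using elements_matI[OF P(1) that refl] P(2) by blast
    have band: "(\<Sum>k<?n. P $$ (k, i) * P $$ (k, j)) = 0"
      if "i < ?n" "j < ?n" "int ?b \<le> \<bar>int i - int j\<bar>" for i j
      using mat_bandwidth_banded(2)[of i "P\<^sup>T * P" j] gram[OF P(1) that(1,2)] that P(1) by simp
    from that(1) obtain A where A: "\<And>r k. r < p - 1 \<Longrightarrow> k < p \<Longrightarrow> A r k \<in> ?S"
      "\<And>w. (\<forall>r<p-1. (\<Sum>k<p. A r k * w k) = 0) \<longleftrightarrow> (\<exists>\<beta>. \<forall>k<p. w k = \<beta> * C.v k)"
      unfolding bal by blast
    have one: "(1::real) \<in> ?S" by simp
    obtain R \<mu> where R: "trivial_kernel {..<?n} {..<?n} R"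
      "\<And>i j. i < ?n \<Longrightarrow> j < ?n \<Longrightarrow> (\<Sum>k<?n. C.m i k * R k j) = \<mu> j * R i j"
      "\<And>i j. i < ?n \<Longrightarrow> j < ?n \<Longrightarrow> R i j \<in> ?S"
      "\<And>i j. i < ?n \<Longrightarrow> j < ?n \<Longrightarrow> int (max (p - 1) ?b) \<le> \<bar>int i - int j\<bar> \<Longrightarrow>
         (\<Sum>k<?n. R k i * R k j) = 0"
      using C.complement_eigenbasis[OF P(3,4) S one mat_bandwidth_banded(1) band A] by blast
    let ?R = "mat ?n ?n (\<lambda>(i, j). R i j)"
    have "elements_mat ?R \<subseteq> ?S" using R(3) by (fastforce dest!: elements_matD)
    moreover have "trivial_kernel {..<?n} {..<?n} (\<lambda>i j. ?R $$ (i, j))"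
      using R(1) by (simp add: trivial_kernel_def)
    moreover have "\<forall>i<?n. \<forall>j<?n. (\<Sum>k<?n. ?M $$ (i, k) * ?R $$ (k, j)) = \<mu> j * ?R $$ (i, j)"
      using R(2) M by simp
    ultimately have "diagonalizes ?S ?R ?M"
      unfolding diagonalizes_iff[OF laplacian_carrier] using mat_carrier by blast
    moreover have "mat_bandwidth (?R\<^sup>T * ?R) \<le> max (p - 1) ?b"
    proof (rule mat_bandwidth_le)
      show "0 < max (p - 1) ?b" using mat_bandwidth_banded(1)[of "P\<^sup>T * P"] by simp
      show "(?R\<^sup>T * ?R) $$ (i, j) = 0"
        if "i < dim_row (?R\<^sup>T * ?R)" "j < dim_col (?R\<^sup>T * ?R)" "int (max (p - 1) ?b) \<le> \<bar>int i - int j\<bar>"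
        for i j
      proof -
        have ij: "i < ?n" "j < ?n" using that(1,2) by simp_all
        have "(?R\<^sup>T * ?R) $$ (i, j) = (\<Sum>k<?n. ?R $$ (k, i) * ?R $$ (k, j))"
          by (rule gram[OF mat_carrier ij])
        then show ?thesis using R(4)[OF ij that(3)] ij by simp
      qed
    qed
    ultimately show ?thesis by blast
  qed
  have iff: "diagonalizable ?S vs (complement G) \<longleftrightarrow> balanced v"
    using balanced complement assms(9) unfolding diagonalizable_def by blast
  moreover have "bandwidth ?S vs (complement G) \<le> enat (max (p - 1) k)"
    if "balanced v" "bandwidth ?S vs G = enat k" for k
  proof -
    let ?B = "\<lambda>G k. 0 < k \<and> (\<exists>P. diagonalizes ?S P (laplacian vs G) \<and> mat_bandwidth (P\<^sup>T * P) = k)"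
    from assms(9) have "\<exists>k. ?B G k" unfolding diagonalizable_def using mat_bandwidth_banded(1) by blast
    \<comment> \<open>The minimum is attained, so \<open>k\<close> is the bandwidth of the Gram
      matrix of an actual \<open>P\<close>.\<close>
    from LeastI_ex[OF this] have "?B G k" using that(2) assms(9) by (simp add: bandwidth_def)
    then obtain P where P: "diagonalizes ?S P ?L" "mat_bandwidth (P\<^sup>T * P) = k" by blast
    from complement[OF that(1) P(1)] obtain R where R: "diagonalizes ?S R ?M"
      "mat_bandwidth (R\<^sup>T * R) \<le> max (p - 1) k" unfolding P(2) by blast
    have "(LEAST k. ?B (complement G) k) \<le> mat_bandwidth (R\<^sup>T * R)"
      by (rule Least_le) (use R(1) mat_bandwidth_banded(1) in blast)
    then show ?thesis using R(2) iff that(1) by (simp add: bandwidth_def)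
  qed
  ultimately show ?thesis by blast
qed

end
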